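(* Fix an observation model $\mathcal{U}$. The proof system $\mathbf{SIG}$ (depending on $\mathcal{U}$) is sound and complete w.r.t. the semantics $\vDash$ of $\mathbf{LDEL}$ over the collection of all epistemic models: for each $\mathbf{LDEL}$ formula $\phi$, $\phi$ is derivable in $\mathbf{SIG}$ if and only if $\mathcal{M},w\vDash\phi$ for every game structure $\mathcal{G}$, every epistemic model $\mathcal{M}$ w.r.t. $\mathcal{G}$ and every state $w$ of $\mathcal{M}$.
   Context: Fixed data: $I$ is a non-empty finite set of players; $A=\biguplus_{i\in I}A_i$ is a non-empty finite set of actions, the sets $A_i$ being mutually disjoint; $P$ is a finite set of information pieces containing a designated piece $p^a$ for each $a\in A$. Game structure: $\mathcal{G}=(S,R,O)$ where $S$ is a non-empty set of states; $R$ is a partial function $S\times A\to S$ such that if $R(s,a)$ is defined then $\iota(s)=i$ for some $i\in I$, where $\iota(s)=i$ iff $\emptyset\subset\{a\mid R(s,a)\text{ is defined}\}\subseteq A_i$; and $O:S\times I\to 2^P$ is a function such that for all $s\in S$, $i\in I$, $a\in A_i$: $p^a\in O(s,i)$ iff $R(s,a)$ is defined. Write $e(s)=\{a\mid R(s,a)\text{ is defined}\}$. Epistemic model w.r.t. $\mathcal{G}$: $\mathcal{M}=(W,f,\sim,V)$ where $W$ is a non-empty set, $f:W\to S$, each $\sim_i$ ($i\in I$) is an equivalence relation on $W$ such that $w\sim_i v$ implies $O(f(w),i)=O(f(v),i)$, and $V:W\times I\to 2^P$ satisfies $V(w,i)=O(f(w),i)$. Observation model: $\mathcal{U}=(A,\leftrightsquigarrow)$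 where each $\leftrightsquigarrow_i$ ($i\in I$) is an equivalence relation on $A$. Update product: $\mathcal{M}\otimes\mathcal{U}=(W',f',\sim',V')$ with $W'=\{(w,a)\mid w\in W, a\in e(f(w))\}$; $f'((w,a))=R(f(w),a)$; $(w,a)\sim'_i(u,b)$ iff $w\sim_i u$, $a\leftrightsquigarrow_i b$ and $O(R(f(w),a),i)=O(R(f(u),b),i)$; $V'((w,a),i)=O(R(f(w),a),i)$. Language $\mathbf{LDEL}$: $\phi::=\top\mid p_i\mid\neg\phi\mid(\phi\wedge\phi)\mid\mathcal{K}_i\phi\mid[a]\phi$, with $i\in I$, $p\in P$, $a\in A$. Abbreviations: usual Booleans, $\hat{\mathcal{K}}_i\phi=\neg\mathcal{K}_i\neg\phi$, $\langle a\rangle\phi=\neg[a]\neg\phi$, $\mathtt{TURN}_i=\bigvee_{a\in A_i}\langle a\rangle\top$. Semantics $\vDash$ on epistemic models $\mathcal{M}=(W,f,\sim,V)$ w.r.t. $\mathcal{G}$: usual clauses for $\top,\neg,\wedge$; $\mathcal{M},w\vDash p_i$ iff $p\in V(w,i)$; $\mathcal{M},w\vDash\mathcal{K}_i\phi$ iff $\mathcal{M},v\vDash\phi$ for all $v$ with $w\sim_iv$; $\mathcal{M},w\vDash[a]\phi$ iff $a\in e(f(w))$ implies $\mathcal{M}\otimes\mathcal{U},(w,a)\vDash\phi$. System $\mathbf{SIG}$ (for all $i\in I$, $a,b\in A$, $p\in P$, formulas $\phi,\psi$). Axioms: all propositional tautology instances; $\mathcal{K}_i(\phi\to\psi)\to(\mathcal{K}_i\phi\to\mathcal{K}_i\psi)$;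 $[a](\phi\to\psi)\to([a]\phi\to[a]\psi)$; (T) $\mathcal{K}_i\phi\to\phi$; (4) $\mathcal{K}_i\phi\to\mathcal{K}_i\mathcal{K}_i\phi$; (5) $\neg\mathcal{K}_i\phi\to\mathcal{K}_i\neg\mathcal{K}_i\phi$; (NM) $\hat{\mathcal{K}}_i\langle b\rangle(\phi\wedge\phi^o_i)\to[a](\phi^o_i\to\hat{\mathcal{K}}_i\phi)$ whenever $a\leftrightsquigarrow_ib$, where $\phi^o_i$ ranges over the formulas $(\bigwedge_{p\in B}p_i)\wedge(\bigwedge_{p\in P\setminus B}\neg p_i)$, $B\subseteq P$; (PR) $\langle a\rangle\hat{\mathcal{K}}_i\phi\to\bigvee_{b:\,a\leftrightsquigarrow_ib}\hat{\mathcal{K}}_i\langle b\rangle\phi$; (DET) $\langle a\rangle\phi\to[a]\phi$; (EXTURN) $\mathtt{TURN}_i\to\bigwedge_{j\neq i}\neg\mathtt{TURN}_j$; (INFO) $\langle a\rangle\top\leftrightarrow p^a_i$ whenever $a\in A_i$; (KE) $(p_i\to\mathcal{K}_ip_i)\wedge(\neg p_i\to\mathcal{K}_i\neg p_i)$. Rules: modus ponens; from $\phi$ infer $\mathcal{K}_i\phi$; from $\phi$ infer $[a]\phi$. *)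

theory Defs
  imports "HOL-Library.Disjoint_Sets"
begin

text \<open>
  Players, actions and information pieces are the elements of finite types \<open>'i\<close>, \<open>'a\<close>, \<open>'p\<close>.
  Throughout, \<open>Acts i\<close> is the set $A_i$ of actions of player \<open>i\<close>, \<open>pc a\<close> is the piece $p^a$
  (no injectivity is demanded of \<open>pc\<close>), and \<open>U i\<close> is the relation of the observation model for
  player \<open>i\<close>.
\<close>

section \<open>Game structures, epistemic models, update product\<close>

record ('s, 'i, 'a, 'p) game =
  states :: "'s set"
  move :: "'s \<Rightarrow> 'a \<Rightarrow> 's option"
  obs :: "'s \<Rightarrow> 'i \<Rightarrow> 'p set"

definition enabled :: "('s, 'i, 'a, 'p) game \<Rightarrow> 's \<Rightarrow> 'a set" where
  "enabled G s = {a. move G s a \<noteq> None}"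

text \<open>\<open>to_move Acts G s i\<close> says $\iota(s) = i$.\<close>

definition to_move :: "('i \<Rightarrow> 'a set) \<Rightarrow> ('s, 'i, 'a, 'p) game \<Rightarrow> 's \<Rightarrow> 'i \<Rightarrow> bool" where
  "to_move Acts G s i \<longleftrightarrow> {} \<subset> enabled G s \<and> enabled G s \<subseteq> Acts i"

definition game_structure ::
  "('i \<Rightarrow> 'a set) \<Rightarrow> ('a \<Rightarrow> 'p) \<Rightarrow> ('s, 'i, 'a, 'p) game \<Rightarrow> bool" where
  "game_structure Acts pc G \<longleftrightarrow>
     states G \<noteq> {} \<and>
     (\<forall>s\<in>states G. \<forall>a t. move G s a = Some t \<longrightarrow> t \<in> states G) \<and>
     (\<forall>s\<in>states G. \<forall>a. move G s a \<noteq> None \<longrightarrow> (\<exists>i. to_move Acts G s i)) \<and>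
     (\<forall>s\<in>states G. \<forall>i. \<forall>a\<in>Acts i. pc a \<in> obs G s i \<longleftrightarrow> move G s a \<noteq> None)"

definition observation_model :: "('i \<Rightarrow> ('a \<times> 'a) set) \<Rightarrow> bool" where
  "observation_model U \<longleftrightarrow> (\<forall>i. equiv UNIV (U i))"

text \<open>
  The semantics of \<open>[a]\<phi>\<close> moves to the update product, whose worlds are pairs of a world and an
  action. So that all iterated products live in a single type, worlds are taken from the following
  type, which contains the arbitrary type \<open>'w\<close> and is closed under pairing with actions:
  \<open>Upd w a\<close> is the pair $(w,a)$. The set of worlds of a model is an arbitrary non-empty subset.
\<close>

datatype ('w, 'a) world = Base 'w | Upd (prev: "('w, 'a) world") (last_act: 'a)

record ('w, 's, 'i, 'a, 'p) emodel =
  worlds :: "('w, 'a) world set"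
  state_of :: "('w, 'a) world \<Rightarrow> 's"
  indist :: "'i \<Rightarrow> (('w, 'a) world \<times> ('w, 'a) world) set"
  val :: "('w, 'a) world \<Rightarrow> 'i \<Rightarrow> 'p set"

definition epistemic_model ::
  "('s, 'i, 'a, 'p) game \<Rightarrow> ('w, 's, 'i, 'a, 'p) emodel \<Rightarrow> bool" where
  "epistemic_model G M \<longleftrightarrow>
     worlds M \<noteq> {} \<and>
     (\<forall>w\<in>worlds M. state_of M w \<in> states G) \<and>
     (\<forall>i. equiv (worlds M) (indist M i)) \<and>
     (\<forall>i. \<forall>(w, v)\<in>indist M i. obs G (state_of M w) i = obs G (state_of M v) i) \<and>
     (\<forall>w\<in>worlds M. \<forall>i. val M w i = obs G (state_of M w) i)"

definition update ::
  "('s, 'i, 'a, 'p) game \<Rightarrow> ('i \<Rightarrow> ('a \<times> 'a) set) \<Rightarrow>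
   ('w, 's, 'i, 'a, 'p) emodel \<Rightarrow> ('w, 's, 'i, 'a, 'p) emodel" where
  "update G U M =
     (let R = (\<lambda>w a. the (move G (state_of M w) a));
          W' = {Upd w a | w a. w \<in> worlds M \<and> a \<in> enabled G (state_of M w)}
      in \<lparr> worlds = W',
           state_of = (\<lambda>x. R (prev x) (last_act x)),
           indist = (\<lambda>i. {(Upd w a, Upd u b) | w a u b.
              Upd w a \<in> W' \<and> Upd u b \<in> W' \<and> (w, u) \<in> indist M i \<and> (a, b) \<in> U i \<and>
              obs G (R w a) i = obs G (R u b) i}),
           val = (\<lambda>x i. obs G (R (prev x) (last_act x)) i) \<rparr>)"

section \<open>Language and semantics\<close>

datatype ('i, 'a, 'p) fm =
    Top
  | Piece 'p 'i
  | Neg "('i, 'a, 'p) fm"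
  | And "('i, 'a, 'p) fm" "('i, 'a, 'p) fm"
  | Know 'i "('i, 'a, 'p) fm"
  | Box 'a "('i, 'a, 'p) fm"

definition Or :: "('i, 'a, 'p) fm \<Rightarrow> ('i, 'a, 'p) fm \<Rightarrow> ('i, 'a, 'p) fm" where
  "Or \<phi> \<psi> = Neg (And (Neg \<phi>) (Neg \<psi>))"

definition Imp :: "('i, 'a, 'p) fm \<Rightarrow> ('i, 'a, 'p) fm \<Rightarrow> ('i, 'a, 'p) fm" where
  "Imp \<phi> \<psi> = Neg (And \<phi> (Neg \<psi>))"

definition Iff :: "('i, 'a, 'p) fm \<Rightarrow> ('i, 'a, 'p) fm \<Rightarrow> ('i, 'a, 'p) fm" where
  "Iff \<phi> \<psi> = And (Imp \<phi> \<psi>) (Imp \<psi> \<phi>)"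

definition Poss :: "'i \<Rightarrow> ('i, 'a, 'p) fm \<Rightarrow> ('i, 'a, 'p) fm" where
  "Poss i \<phi> = Neg (Know i (Neg \<phi>))"

definition Dia :: "'a \<Rightarrow> ('i, 'a, 'p) fm \<Rightarrow> ('i, 'a, 'p) fm" where
  "Dia a \<phi> = Neg (Box a (Neg \<phi>))"

text \<open>
  Conjunctions and disjunctions indexed by a finite set follow a fixed enumeration of that set;
  the empty conjunction is \<open>Top\<close> and the empty disjunction is \<open>Neg Top\<close>.
\<close>

definition listing :: "'x set \<Rightarrow> 'x list" where
  "listing X = (SOME xs. set xs = X \<and> distinct xs)"

definition BigAnd :: "'x set \<Rightarrow> ('x \<Rightarrow> ('i, 'a, 'p) fm) \<Rightarrow> ('i, 'a, 'p) fm" where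
  "BigAnd X F = foldr (\<lambda>x. And (F x)) (listing X) Top"

definition BigOr :: "'x set \<Rightarrow> ('x \<Rightarrow> ('i, 'a, 'p) fm) \<Rightarrow> ('i, 'a, 'p) fm" where
  "BigOr X F = foldr (\<lambda>x. Or (F x)) (listing X) (Neg Top)"

definition TURN :: "('i \<Rightarrow> 'a set) \<Rightarrow> 'i \<Rightarrow> ('i, 'a, 'p) fm" where
  "TURN Acts i = BigOr (Acts i) (\<lambda>a. Dia a Top)"

text \<open>The formulas $\phi^o_i$ are \<open>obs_fm B i\<close> for \<open>B\<close> a set of pieces.\<close>

definition obs_fm :: "'p set \<Rightarrow> 'i \<Rightarrow> ('i, 'a, 'p) fm" where
  "obs_fm B i = And (BigAnd B (\<lambda>p. Piece p i)) (BigAnd (UNIV - B) (\<lambda>p. Neg (Piece p i)))"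

fun sat ::
  "('s, 'i, 'a, 'p) game \<Rightarrow> ('i \<Rightarrow> ('a \<times> 'a) set) \<Rightarrow> ('w, 's, 'i, 'a, 'p) emodel \<Rightarrow>
   ('w, 'a) world \<Rightarrow> ('i, 'a, 'p) fm \<Rightarrow> bool" where
  "sat G U M w Top \<longleftrightarrow> True"
| "sat G U M w (Piece p i) \<longleftrightarrow> p \<in> val M w i"
| "sat G U M w (Neg \<phi>) \<longleftrightarrow> \<not> sat G U M w \<phi>"
| "sat G U M w (And \<phi> \<psi>) \<longleftrightarrow> sat G U M w \<phi> \<and> sat G U M w \<psi>"
| "sat G U M w (Know i \<phi>) \<longleftrightarrow> (\<forall>v. (w, v) \<in> indist M i \<longrightarrow> sat G U M v \<phi>)"
| "sat G U M w (Box a \<phi>) \<longleftrightarrow>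
     (a \<in> enabled G (state_of M w) \<longrightarrow> sat G U (update G U M) (Upd w a) \<phi>)"

text \<open>
  The type arguments fix the types that the states of game structures and the base worlds of
  epistemic models are drawn from. Every choice is meaningful for soundness. For completeness the
  state type has to be infinite to offer enough game structures (those with finitely many states
  are included, as \<open>states G\<close> is any non-empty subset); no such condition is needed on \<open>'w\<close>,
  since \<open>('w, 'a) world\<close> is infinite anyway.
\<close>

definition valid ::
  "'s itself \<Rightarrow> 'w itself \<Rightarrow> ('i \<Rightarrow> 'a set) \<Rightarrow> ('a \<Rightarrow> 'p) \<Rightarrow> ('i \<Rightarrow> ('a \<times> 'a) set) \<Rightarrow>
   ('i, 'a, 'p) fm \<Rightarrow> bool" where
  "valid _ _ Acts pc U \<phi> \<longleftrightarrow>
     (\<forall>(G :: ('s, 'i, 'a, 'p) game) (M :: ('w, 's, 'i, 'a, 'p) emodel) w.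
        game_structure Acts pc G \<longrightarrow> epistemic_model G M \<longrightarrow> w \<in> worlds M \<longrightarrow> sat G U M w \<phi>)"

section \<open>The proof system\<close>

text \<open>
  A formula is an instance of a propositional tautology iff it is true under every Boolean
  valuation \<open>v\<close> of its subformulas not built by \<open>Top\<close>, \<open>Neg\<close>, \<open>And\<close>.
\<close>

fun prop_eval :: "(('i, 'a, 'p) fm \<Rightarrow> bool) \<Rightarrow> ('i, 'a, 'p) fm \<Rightarrow> bool" where
  "prop_eval v Top \<longleftrightarrow> True"
| "prop_eval v (Neg \<phi>) \<longleftrightarrow> \<not> prop_eval v \<phi>"
| "prop_eval v (And \<phi> \<psi>) \<longleftrightarrow> prop_eval v \<phi> \<and> prop_eval v \<psi>"
| "prop_eval v (Piece p i) \<longleftrightarrow> v (Piece p i)"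
| "prop_eval v (Know i \<phi>) \<longleftrightarrow> v (Know i \<phi>)"
| "prop_eval v (Box a \<phi>) \<longleftrightarrow> v (Box a \<phi>)"

definition tautology :: "('i, 'a, 'p) fm \<Rightarrow> bool" where
  "tautology \<phi> \<longleftrightarrow> (\<forall>v. prop_eval v \<phi>)"

inductive SIG ::
  "('i \<Rightarrow> 'a set) \<Rightarrow> ('a \<Rightarrow> 'p) \<Rightarrow> ('i \<Rightarrow> ('a \<times> 'a) set) \<Rightarrow> ('i, 'a, 'p) fm \<Rightarrow> bool"
  for Acts pc U where
  TAUT: "tautology \<phi> \<Longrightarrow> SIG Acts pc U \<phi>"
| DISTK: "SIG Acts pc U (Imp (Know i (Imp \<phi> \<psi>)) (Imp (Know i \<phi>) (Know i \<psi>)))"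
| DISTBOX: "SIG Acts pc U (Imp (Box a (Imp \<phi> \<psi>)) (Imp (Box a \<phi>) (Box a \<psi>)))"
| AxT: "SIG Acts pc U (Imp (Know i \<phi>) \<phi>)"
| Ax4: "SIG Acts pc U (Imp (Know i \<phi>) (Know i (Know i \<phi>)))"
| Ax5: "SIG Acts pc U (Imp (Neg (Know i \<phi>)) (Know i (Neg (Know i \<phi>))))"
| NM: "(a, b) \<in> U i \<Longrightarrow>
    SIG Acts pc U (Imp (Poss i (Dia b (And \<phi> (obs_fm B i)))) (Box a (Imp (obs_fm B i) (Poss i \<phi>))))"
| PR: "SIG Acts pc U (Imp (Dia a (Poss i \<phi>)) (BigOr {b. (a, b) \<in> U i} (\<lambda>b. Poss i (Dia b \<phi>))))"
| DET: "SIG Acts pc U (Imp (Dia a \<phi>) (Box a \<phi>))"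
| EXTURN: "SIG Acts pc U (Imp (TURN Acts i) (BigAnd {j. j \<noteq> i} (\<lambda>j. Neg (TURN Acts j))))"
| INFO: "a \<in> Acts i \<Longrightarrow> SIG Acts pc U (Iff (Dia a Top) (Piece (pc a) i))"
| KE: "SIG Acts pc U (And (Imp (Piece p i) (Know i (Piece p i)))
                          (Imp (Neg (Piece p i)) (Know i (Neg (Piece p i)))))"
| MP: "SIG Acts pc U \<phi> \<Longrightarrow> SIG Acts pc U (Imp \<phi> \<psi>) \<Longrightarrow> SIG Acts pc U \<psi>"
| NECK: "SIG Acts pc U \<phi> \<Longrightarrow> SIG Acts pc U (Know i \<phi>)"
| NECBOX: "SIG Acts pc U \<phi> \<Longrightarrow> SIG Acts pc U (Box a \<phi>)"

end

theory Submission
  imports Defs "HOL-Library.Countable_Set"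
begin

text \<open>
  Completeness rests on a canonical game: its states are maximal consistent sets \<open>S\<close>, an action
  \<open>a\<close> leads from \<open>S\<close> to \<open>{\<phi>. Box a \<phi> \<in> S}\<close>, and player \<open>i\<close> observes the pieces \<open>p\<close> with
  \<open>Piece p i \<in> S\<close>. Call a model over this game faithful if indistinguishable worlds have
  \<open>Know i\<close>-compatible states and every \<open>Poss i \<psi>\<close> in the state of a world has a witness among the
  worlds. The axioms NM and PR (with KE) ensure that the update product of a faithful model is again
  faithful, so the truth lemma follows by induction on formulas, simultaneously for all faithful
  models. Since faithfulness asks for witnesses of single formulas only, a countable
  set of maximal consistent sets suffices, and it embeds into any infinite type of states.
\<close>

section \<open>Semantics of the derived connectives and of the update product\<close>

lemma set_listing: "finite X \<Longrightarrow> set (listing X) = X"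
  unfolding listing_def by (rule someI2_ex) (auto dest: finite_distinct_list)

lemma sat_derived [simp]:
  "sat G U M w (Imp \<phi> \<psi>) \<longleftrightarrow> (sat G U M w \<phi> \<longrightarrow> sat G U M w \<psi>)"
  "sat G U M w (Or \<phi> \<psi>) \<longleftrightarrow> sat G U M w \<phi> \<or> sat G U M w \<psi>"
  "sat G U M w (Iff \<phi> \<psi>) \<longleftrightarrow> (sat G U M w \<phi> \<longleftrightarrow> sat G U M w \<psi>)"
  "sat G U M w (Poss i \<phi>) \<longleftrightarrow> (\<exists>v. (w, v) \<in> indist M i \<and> sat G U M v \<phi>)"
  "sat G U M w (Dia a \<phi>) \<longleftrightarrow>
     a \<in> enabled G (state_of M w) \<and> sat G U (update G U M) (Upd w a) \<phi>"
  by (auto simp: Imp_def Or_def Iff_def Poss_def Dia_def)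

lemma sat_BigAnd [simp]:
  assumes "finite X"
  shows "sat G U M w (BigAnd X F) \<longleftrightarrow> (\<forall>x\<in>X. sat G U M w (F x))"
proof -
  have "sat G U M w (foldr (\<lambda>x. And (F x)) xs Top) \<longleftrightarrow> (\<forall>x\<in>set xs. sat G U M w (F x))" for xs
    by (induction xs) auto
  then show ?thesis by (simp add: BigAnd_def set_listing assms)
qed

lemma sat_BigOr [simp]:
  assumes "finite X"
  shows "sat G U M w (BigOr X F) \<longleftrightarrow> (\<exists>x\<in>X. sat G U M w (F x))"
proof -
  have "sat G U M w (foldr (\<lambda>x. Or (F x)) xs (Neg Top)) \<longleftrightarrow> (\<exists>x\<in>set xs. sat G U M w (F x))" for xs
    by (induction xs) auto
  then show ?thesis by (simp add: BigOr_def set_listing assms)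
qed

lemma sat_TURN [simp]:
  fixes Acts :: "'i \<Rightarrow> ('a::finite) set"
  shows "sat G U M w (TURN Acts i) \<longleftrightarrow> (\<exists>a\<in>Acts i. a \<in> enabled G (state_of M w))"
  by (simp add: TURN_def)

lemma sat_obs_fm [simp]:
  fixes B :: "('p::finite) set"
  shows "sat G U M w (obs_fm B i) \<longleftrightarrow> val M w i = B"
  by (auto simp: obs_fm_def)

lemma update_simps [simp]:
  "x \<in> worlds (update G U M) \<longleftrightarrow>
     (\<exists>w a. x = Upd w a \<and> w \<in> worlds M \<and> a \<in> enabled G (state_of M w))"
  "state_of (update G U M) (Upd w a) = the (move G (state_of M w) a)"
  "val (update G U M) (Upd w a) i = obs G (the (move G (state_of M w) a)) i"
  by (auto simp: update_def Let_def)

lemma indist_update_iff [simp]: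
  "(x, y) \<in> indist (update G U M) i \<longleftrightarrow>
     (\<exists>w a u b. x = Upd w a \<and> y = Upd u b \<and>
        w \<in> worlds M \<and> a \<in> enabled G (state_of M w) \<and>
        u \<in> worlds M \<and> b \<in> enabled G (state_of M u) \<and> (w, u) \<in> indist M i \<and> (a, b) \<in> U i \<and>
        obs G (the (move G (state_of M w) a)) i = obs G (the (move G (state_of M u) b)) i)"
  by (auto simp: update_def Let_def)

section \<open>Epistemic models and their update products\<close>

lemma epistemic_modelD:
  assumes "epistemic_model G M"
  shows "\<And>w. w \<in> worlds M \<Longrightarrow> state_of M w \<in> states G"
    and "\<And>i. equiv (worlds M) (indist M i)"
    and "\<And>i w v. (w, v) \<in> indist M i \<Longrightarrow> obs G (state_of M w) i = obs G (state_of M v) i"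
    and "\<And>w i. w \<in> worlds M \<Longrightarrow> val M w i = obs G (state_of M w) i"
    and "\<And>i w v. (w, v) \<in> indist M i \<Longrightarrow> w \<in> worlds M \<and> v \<in> worlds M"
    and "\<And>i w. w \<in> worlds M \<Longrightarrow> (w, w) \<in> indist M i"
    and "\<And>i w v. (w, v) \<in> indist M i \<Longrightarrow> (v, w) \<in> indist M i"
    and "\<And>i w v u. (w, v) \<in> indist M i \<Longrightarrow> (v, u) \<in> indist M i \<Longrightarrow> (w, u) \<in> indist M i"
proof -
  show e: "equiv (worlds M) (indist M i)" for i
    using assms by (simp add: epistemic_model_def)
  show "w \<in> worlds M \<Longrightarrow> state_of M w \<in> states G" for w
    using assms by (simp add: epistemic_model_def)
  show "(w, v) \<in> indist M i \<Longrightarrow> obs G (state_of M w) i = obs G (state_of M v) i" for i w v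
    using assms unfolding epistemic_model_def by fast
  show "w \<in> worlds M \<Longrightarrow> val M w i = obs G (state_of M w) i" for w i
    using assms by (simp add: epistemic_model_def)
  show "(w, v) \<in> indist M i \<Longrightarrow> w \<in> worlds M \<and> v \<in> worlds M" for i w v
    using equiv_type[OF e] by blast
  show "w \<in> worlds M \<Longrightarrow> (w, w) \<in> indist M i" for i w
    using equiv_class_self[OF e] by blast
  show "(w, v) \<in> indist M i \<Longrightarrow> (v, w) \<in> indist M i" for i w v
    using e by (meson equivE symE)
  show "(w, v) \<in> indist M i \<Longrightarrow> (v, u) \<in> indist M i \<Longrightarrow> (w, u) \<in> indist M i" for i w v u
    using e by (meson equivE transE)
qed

text \<open>Indistinguishability in the product combines three equivalences: that of
  \<open>M\<close> on worlds, that of \<open>U\<close> on actions, and equality of the observations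
  made after the move. The enabled pair \<open>w\<close>, \<open>a\<close> guarantees that the
  product has a world.\<close>

lemma epistemic_model_update:
  assumes G: "game_structure Acts pc G" and U: "observation_model U" and M: "epistemic_model G M"
    and w: "w \<in> worlds M" and a: "a \<in> enabled G (state_of M w)"
  shows "epistemic_model G (update G U M)"
proof -
  note MD = epistemic_modelD[OF M]
  have R: "the (move G (state_of M w) a) \<in> states G"
    if "w \<in> worlds M" "a \<in> enabled G (state_of M w)" for w a
    using G MD(1)[OF that(1)] that(2) by (auto simp: game_structure_def enabled_def)
  have eqU: "equiv UNIV (U i)" for i
    using U by (simp add: observation_model_def)
  have U_refl: "(a, a) \<in> U i" for a i
    using equiv_class_self[OF eqU] by blast
  have U_sym: "(a, b) \<in> U i \<Longrightarrow> (b, a) \<in> U i" for a b i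
    using eqU by (meson equivE symE)
  have U_trans: "(a, b) \<in> U i \<Longrightarrow> (b, c) \<in> U i \<Longrightarrow> (a, c) \<in> U i" for a b c i
    using eqU by (meson equivE transE)
  have "equiv (worlds (update G U M)) (indist (update G U M) i)" for i
  proof (rule equivI)
    show "refl_on (worlds (update G U M)) (indist (update G U M) i)"
      by (rule refl_onI) (auto simp: U_refl MD(6))
    show "sym (indist (update G U M) i)"
      by (rule symI) (auto intro: U_sym MD(7))
    show "trans (indist (update G U M) i)"
      by (rule transI) (auto intro: U_trans MD(8))
    show "indist (update G U M) i \<subseteq> worlds (update G U M) \<times> worlds (update G U M)"
      by auto
  qed
  moreover have "worlds (update G U M) \<noteq> {}"
    using w a by (metis empty_iff update_simps(1))
  ultimately show ?thesis
    unfolding epistemic_model_def by (auto simp: R)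
qed

section \<open>Soundness\<close>

text \<open>Satisfaction at a fixed world is itself a Boolean valuation of the atomic and modal
  formulas, so every tautology holds there.\<close>

lemma prop_eval_sat: "prop_eval (sat G U M w) \<phi> \<longleftrightarrow> sat G U M w \<phi>"
  by (induction \<phi>) auto

text \<open>The induction ranges over all models of the game, since the premise of
  \<open>NECBOX\<close> is needed in the update product, which is again an epistemic model over the
  same game.\<close>

lemma SIG_sound:
  fixes Acts :: "'i::finite \<Rightarrow> ('a::finite) set"
    and pc :: "'a \<Rightarrow> 'p::finite"
  assumes disj: "disjoint_family Acts" and U: "observation_model U" and G: "game_structure Acts pc G"
    and "SIG Acts pc U \<phi>" and "epistemic_model G M" and "w \<in> worlds M"
  shows "sat G U M w \<phi>"
  using assms(4-)
proof (induction arbitrary: M w)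
  case (TAUT \<phi>)
  then show ?case by (metis prop_eval_sat tautology_def)
next
  case (AxT i \<phi>)
  then show ?case using epistemic_modelD(6)[OF AxT(1)] by simp
next
  case (Ax4 i \<phi>)
  then show ?case using epistemic_modelD(8)[OF Ax4(1)] by auto
next
  case (Ax5 i \<phi>)
  have "(v, u) \<in> indist M i" if "(w, v) \<in> indist M i" "(w, u) \<in> indist M i" for u v
    using epistemic_modelD(7,8)[OF Ax5(1)] that by meson
  then show ?case by auto
next
  \<comment> \<open>The two occurrences of \<open>obs_fm B i\<close> force the observations after
    \<open>a\<close> and after \<open>b\<close> both to be \<open>B\<close>, which is the remaining
    condition for relating the two product worlds.\<close>
  case (NM a b i \<phi> B)
  then show ?case using epistemic_modelD(5)[OF NM(2)] by simp blast
next
  case (PR a i \<phi>)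
  then show ?case by auto
next
  case (EXTURN i)
  \<comment> \<open>All enabled actions belong to one player, so by disjointness no second player
    can have the turn.\<close>
  have "\<exists>k. enabled G (state_of M w) \<subseteq> Acts k" if "a \<in> enabled G (state_of M w)" for a
    using G epistemic_modelD(1)[OF EXTURN] that
    by (auto simp: game_structure_def to_move_def enabled_def)
  then show ?case
    using disj by (auto simp: disjoint_family_on_def) (metis UNIV_I disjoint_iff subsetD)
next
  case (INFO a i)
  then show ?case
    using G epistemic_modelD(1)[OF INFO(2,3)] epistemic_modelD(4)[OF INFO(2,3)]
    by (auto simp: game_structure_def enabled_def)
next
  case (KE p i)
  have "val M v i = val M w i" if "(w, v) \<in> indist M i" for v
    using epistemic_modelD(3,4,5)[OF KE(1)] that by metis
  then show ?case by simp
next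
  case (NECK \<phi> i)
  then show ?case using epistemic_modelD(5)[OF NECK(3)] by simp
next
  case (NECBOX \<phi> a)
  then show ?case using epistemic_model_update[OF G U NECBOX(3)] by simp
qed auto

section \<open>Maximal consistent sets\<close>

locale SIG_calculus =
  fixes Acts :: "'i::finite \<Rightarrow> ('a::finite) set"
    and pc :: "'a \<Rightarrow> 'p::finite"
    and U :: "'i \<Rightarrow> ('a \<times> 'a) set"
begin

text \<open>Necessitation is confined to theorems and never applied to hypotheses; this is what
  makes the deduction theorem hold.\<close>

inductive ded :: "('i, 'a, 'p) fm set \<Rightarrow> ('i, 'a, 'p) fm \<Rightarrow> bool" for S where
  ded_SIG: "SIG Acts pc U \<phi> \<Longrightarrow> ded S \<phi>"
| ded_hyp: "\<phi> \<in> S \<Longrightarrow> ded S \<phi>"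
| ded_MP: "ded S \<phi> \<Longrightarrow> ded S (Imp \<phi> \<psi>) \<Longrightarrow> ded S \<psi>"

text \<open>Maximal consistency is phrased by the closure properties that later arguments use; the
  last conjunct covers both consistency and the decision of every formula.\<close>

definition mcs :: "('i, 'a, 'p) fm set \<Rightarrow> bool" where
  "mcs S \<longleftrightarrow> (\<forall>\<phi>. SIG Acts pc U \<phi> \<longrightarrow> \<phi> \<in> S) \<and> (\<forall>\<phi> \<psi>. \<phi> \<in> S \<longrightarrow> Imp \<phi> \<psi> \<in> S \<longrightarrow> \<psi> \<in> S) \<and>
     (\<forall>\<phi>. Neg \<phi> \<in> S \<longleftrightarrow> \<phi> \<notin> S)"

lemmas taut_simps = tautology_def Imp_def Or_def Iff_def

lemma ded_mono: "ded S \<phi> \<Longrightarrow> S \<subseteq> T \<Longrightarrow> ded T \<phi>"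
  by (induction rule: ded.induct) (auto intro: ded.intros)

lemma ded_deduction: "ded (insert \<phi> S) \<psi> \<Longrightarrow> ded S (Imp \<phi> \<psi>)"
proof (induction rule: ded.induct)
  case (ded_SIG \<psi>)
  have "SIG Acts pc U (Imp \<psi> (Imp \<phi> \<psi>))"
    by (rule TAUT) (simp add: taut_simps)
  then show ?case by (metis ded_SIG SIG.MP ded.ded_SIG)
next
  case (ded_hyp \<psi>)
  show ?case
  proof (cases "\<psi> = \<phi>")
    case True
    have "SIG Acts pc U (Imp \<phi> \<phi>)"
      by (rule TAUT) (simp add: taut_simps)
    then show ?thesis using True by (auto intro: ded.intros)
  next
    case False
    have "SIG Acts pc U (Imp \<psi> (Imp \<phi> \<psi>))"
      by (rule TAUT) (simp add: taut_simps)
    then show ?thesis using False ded_hyp by (auto intro: ded.intros)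
  qed
next
  case (ded_MP \<chi> \<psi>)
  have "SIG Acts pc U (Imp (Imp \<phi> \<chi>) (Imp (Imp \<phi> (Imp \<chi> \<psi>)) (Imp \<phi> \<psi>)))"
    by (rule TAUT) (simp add: taut_simps)
  then show ?case using ded_MP.IH by (meson ded.intros)
qed

text \<open>A derivation uses finitely many hypotheses, and in a chain these lie in a single member.
  For modus ponens, the larger of the two members derives both premises.\<close>

lemma ded_Union_chain:
  assumes "ded (\<Union>\<C>) \<phi>" and "subset.chain \<A> \<C>" and "\<C> \<noteq> {}"
  shows "\<exists>S\<in>\<C>. ded S \<phi>"
  using assms(1)
proof (induction rule: ded.induct)
  case (ded_SIG \<phi>)
  then show ?case using assms(3) by (auto intro: ded.intros)
next
  case (ded_hyp \<phi>)
  then show ?case by (auto intro: ded.intros)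
next
  case (ded_MP \<phi> \<psi>)
  then obtain S T where ST: "S \<in> \<C>" "ded S \<phi>" "T \<in> \<C>" "ded T (Imp \<phi> \<psi>)" by blast
  then have "S \<subseteq> T \<or> T \<subseteq> S" using assms(2) by (auto simp: subset.chain_def)
  then show ?case using ST by (meson ded.ded_MP ded_mono)
qed

lemma Lindenbaum:
  assumes "\<not> ded S (Neg Top)"
  obtains T where "S \<subseteq> T" "mcs T"
proof -
  let ?A = "{T. S \<subseteq> T \<and> \<not> ded T (Neg Top)}"
  have "\<exists>T\<in>?A. \<forall>X\<in>?A. T \<subseteq> X \<longrightarrow> X = T"
  proof (rule subset_Zorn_nonempty)
    show "?A \<noteq> {}" using assms by blast
    show "\<Union>\<C> \<in> ?A" if "\<C> \<noteq> {}" "subset.chain ?A \<C>" for \<C>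
    proof -
      have "\<C> \<subseteq> ?A" using that(2) by (simp add: subset.chain_def)
      then show ?thesis using that ded_Union_chain[OF _ that(2,1)] by blast
    qed
  qed
  then obtain T where T: "S \<subseteq> T" "\<not> ded T (Neg Top)"
    and max: "\<And>X. T \<subseteq> X \<Longrightarrow> \<not> ded X (Neg Top) \<Longrightarrow> X = T"
    by (smt (verit) mem_Collect_eq subset_trans)
  \<comment> \<open>By the deduction theorem, adding a derivable formula to \<open>T\<close>
    preserves consistency, so maximality puts it into \<open>T\<close> already.\<close>
  have closed: "\<phi> \<in> T" if "ded T \<phi>" for \<phi>
  proof -
    have "\<not> ded (insert \<phi> T) (Neg Top)"
      using T(2) that by (meson ded.ded_MP ded_deduction)
    then show ?thesis using max[of "insert \<phi> T"] by blast
  qed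
  have "Neg \<phi> \<in> T" if "\<phi> \<notin> T" for \<phi>
  proof -
    have "ded (insert \<phi> T) (Neg Top)"
      using max[of "insert \<phi> T"] that by blast
    then have "ded T (Imp \<phi> (Neg Top))" by (rule ded_deduction)
    moreover have "SIG Acts pc U (Imp (Imp \<phi> (Neg Top)) (Neg \<phi>))"
      by (rule TAUT) (simp add: taut_simps)
    ultimately show ?thesis by (meson closed ded.intros)
  qed
  moreover have False if "\<phi> \<in> T" "Neg \<phi> \<in> T" for \<phi>
  proof -
    have "SIG Acts pc U (Imp \<phi> (Imp (Neg \<phi>) (Neg Top)))"
      by (rule TAUT) (simp add: taut_simps)
    then show False using that T(2) by (meson ded.intros)
  qed
  ultimately have "mcs T"
    unfolding mcs_def by (meson closed ded.intros)
  with T(1) show thesis by (rule that)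
qed

lemma mcs_SIG: "mcs S \<Longrightarrow> SIG Acts pc U \<phi> \<Longrightarrow> \<phi> \<in> S"
  and mcs_Neg [simp]: "mcs S \<Longrightarrow> Neg \<phi> \<in> S \<longleftrightarrow> \<phi> \<notin> S"
  and mcs_MP: "mcs S \<Longrightarrow> \<phi> \<in> S \<Longrightarrow> Imp \<phi> \<psi> \<in> S \<Longrightarrow> \<psi> \<in> S"
  unfolding mcs_def by blast+

lemma mcs_Imp_SIG: "mcs S \<Longrightarrow> SIG Acts pc U (Imp \<phi> \<psi>) \<Longrightarrow> \<phi> \<in> S \<Longrightarrow> \<psi> \<in> S"
  using mcs_SIG mcs_MP by blast

lemma mcs_Top [simp]: "mcs S \<Longrightarrow> Top \<in> S"
  by (rule mcs_SIG) (auto intro!: TAUT simp: taut_simps)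

lemma mcs_And [simp]:
  assumes "mcs S"
  shows "And \<phi> \<psi> \<in> S \<longleftrightarrow> \<phi> \<in> S \<and> \<psi> \<in> S"
proof -
  have "SIG Acts pc U (Imp (And \<phi> \<psi>) \<phi>)" "SIG Acts pc U (Imp (And \<phi> \<psi>) \<psi>)"
    "SIG Acts pc U (Imp \<phi> (Imp \<psi> (And \<phi> \<psi>)))"
    by (auto intro!: TAUT simp: taut_simps)
  then show ?thesis using mcs_Imp_SIG[OF assms] mcs_MP[OF assms] by blast
qed

lemma mcs_derived [simp]:
  assumes "mcs S"
  shows "Imp \<phi> \<psi> \<in> S \<longleftrightarrow> (\<phi> \<in> S \<longrightarrow> \<psi> \<in> S)"
    and "Or \<phi> \<psi> \<in> S \<longleftrightarrow> \<phi> \<in> S \<or> \<psi> \<in> S"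
    and "Iff \<phi> \<psi> \<in> S \<longleftrightarrow> (\<phi> \<in> S \<longleftrightarrow> \<psi> \<in> S)"
    and "Poss i \<phi> \<in> S \<longleftrightarrow> Know i (Neg \<phi>) \<notin> S"
    and "Dia a \<phi> \<in> S \<longleftrightarrow> Box a (Neg \<phi>) \<notin> S"
  using assms by (auto simp: Imp_def Or_def Iff_def Poss_def Dia_def)

lemma mcs_BigAnd [simp]:
  assumes "mcs S" "finite X"
  shows "BigAnd X F \<in> S \<longleftrightarrow> (\<forall>x\<in>X. F x \<in> S)"
proof -
  have "foldr (\<lambda>x. And (F x)) xs Top \<in> S \<longleftrightarrow> (\<forall>x\<in>set xs. F x \<in> S)" for xs
    using assms(1) by (induction xs) auto
  then show ?thesis by (simp add: BigAnd_def set_listing assms)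
qed

lemma mcs_BigOr [simp]:
  assumes "mcs S" "finite X"
  shows "BigOr X F \<in> S \<longleftrightarrow> (\<exists>x\<in>X. F x \<in> S)"
proof -
  have "foldr (\<lambda>x. Or (F x)) xs (Neg Top) \<in> S \<longleftrightarrow> (\<exists>x\<in>set xs. F x \<in> S)" for xs
    using assms(1) by (induction xs) auto
  then show ?thesis by (simp add: BigOr_def set_listing assms)
qed

lemma mcs_obs_fm [simp]: "mcs S \<Longrightarrow> obs_fm B i \<in> S \<longleftrightarrow> {p. Piece p i \<in> S} = B"
  by (auto simp: obs_fm_def)

section \<open>Modal reasoning inside maximal consistent sets\<close>

lemma SIG_Know_mono:
  assumes "SIG Acts pc U (Imp \<phi> \<psi>)"
  shows "SIG Acts pc U (Imp (Know i \<phi>) (Know i \<psi>))"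
  by (rule SIG.MP[OF NECK[OF assms] DISTK])

lemma SIG_Box_mono:
  assumes "SIG Acts pc U (Imp \<phi> \<psi>)"
  shows "SIG Acts pc U (Imp (Box a \<phi>) (Box a \<psi>))"
  by (rule SIG.MP[OF NECBOX[OF assms] DISTBOX])

lemma mcs_Know_mono:
  "mcs S \<Longrightarrow> SIG Acts pc U (Imp \<phi> \<psi>) \<Longrightarrow> Know i \<phi> \<in> S \<Longrightarrow> Know i \<psi> \<in> S"
  by (rule mcs_Imp_SIG[OF _ SIG_Know_mono])

lemma mcs_Know_MP:
  "mcs S \<Longrightarrow> Know i (Imp \<phi> \<psi>) \<in> S \<Longrightarrow> Know i \<phi> \<in> S \<Longrightarrow> Know i \<psi> \<in> S"
  by (rule mcs_MP[OF _ _ mcs_MP[OF _ _ mcs_SIG[OF _ DISTK]]])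

text \<open>Axiom \<open>KE\<close> makes a player's observations readable off what the player
  knows. Hence sets that agree on the knowledge of \<open>i\<close> also agree on the observations
  of \<open>i\<close>.\<close>

lemma mcs_Piece_Know:
  assumes "mcs S"
  shows "Know i (Piece p i) \<in> S \<longleftrightarrow> Piece p i \<in> S"
proof
  show "Know i (Piece p i) \<in> S \<Longrightarrow> Piece p i \<in> S"
    by (rule mcs_Imp_SIG[OF assms AxT])
  show "Piece p i \<in> S \<Longrightarrow> Know i (Piece p i) \<in> S"
    using mcs_SIG[OF assms KE, of p i] assms by simp
qed

section \<open>The canonical game\<close>

definition box_image :: "('i, 'a, 'p) fm set \<Rightarrow> 'a \<Rightarrow> ('i, 'a, 'p) fm set" where
  "box_image S a = {\<phi>. Box a \<phi> \<in> S}"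

definition same_know :: "'i \<Rightarrow> ('i, 'a, 'p) fm set \<Rightarrow> ('i, 'a, 'p) fm set \<Rightarrow> bool" where
  "same_know i S T \<longleftrightarrow> (\<forall>\<phi>. Know i \<phi> \<in> S \<longleftrightarrow> Know i \<phi> \<in> T)"

text \<open>\<open>Dia a Top\<close> yields at least one successor and \<open>DET\<close> at most
  one, so \<open>Box a\<close> commutes with negation. The image is thus already maximal consistent,
  without any Lindenbaum extension.\<close>

lemma mcs_box_image:
  assumes S: "mcs S" and a: "Dia a Top \<in> S"
  shows "mcs (box_image S a)"
proof -
  have nec: "Box a \<phi> \<in> S" if "SIG Acts pc U \<phi>" for \<phi>
    using mcs_SIG[OF S] NECBOX[OF that] by blast
  have mp: "Box a \<psi> \<in> S" if "Box a \<phi> \<in> S" "Box a (Imp \<phi> \<psi>) \<in> S" for \<phi> \<psi>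
    using mcs_SIG[OF S DISTBOX[of _ _ _ a \<phi> \<psi>]] that S by simp
  have "Box a (Neg \<phi>) \<in> S \<longleftrightarrow> Box a \<phi> \<notin> S" for \<phi>
  proof
    assume 1: "Box a (Neg \<phi>) \<in> S"
    have "SIG Acts pc U (Imp \<phi> (Imp (Neg \<phi>) (Neg Top)))"
      by (rule TAUT) (simp add: taut_simps)
    then have "Box a (Neg Top) \<in> S" if "Box a \<phi> \<in> S"
      using mp nec 1 that by meson
    then show "Box a \<phi> \<notin> S" using a S by auto
  next
    assume "Box a \<phi> \<notin> S"
    moreover have "Box a (Neg (Neg \<phi>)) \<in> S \<Longrightarrow> Box a \<phi> \<in> S"
      by (rule mcs_Imp_SIG[OF S SIG_Box_mono]) (auto intro!: TAUT simp: taut_simps)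
    ultimately show "Box a (Neg \<phi>) \<in> S"
      using mcs_SIG[OF S DET[of _ _ _ a "Neg \<phi>"]] S by auto
  qed
  then show ?thesis
    unfolding mcs_def box_image_def using nec mp by blast
qed

lemma mem_box_image:
  assumes S: "mcs S" and a: "Dia a Top \<in> S"
  shows "\<phi> \<in> box_image S a \<longleftrightarrow> Box a \<phi> \<in> S" "\<phi> \<in> box_image S a \<longleftrightarrow> Dia a \<phi> \<in> S"
proof -
  show "\<phi> \<in> box_image S a \<longleftrightarrow> Box a \<phi> \<in> S" by (simp add: box_image_def)
  show "\<phi> \<in> box_image S a \<longleftrightarrow> Dia a \<phi> \<in> S"
    using mcs_Neg[OF mcs_box_image[OF assms], of \<phi>] S by (simp add: box_image_def)
qed

lemma Dia_imp_enabled: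
  assumes S: "mcs S" and "Dia a \<phi> \<in> S"
  shows "Dia a Top \<in> S"
proof -
  have "Box a (Neg Top) \<in> S \<Longrightarrow> Box a (Neg \<phi>) \<in> S"
    by (rule mcs_Imp_SIG[OF S SIG_Box_mono]) (auto intro!: TAUT simp: taut_simps)
  then show ?thesis using assms by auto
qed

text \<open>The hypotheses keep their prefix \<open>Know i\<close>, at the price of axiom
  \<open>Ax4\<close> in the hypothesis case. In return, an extension of them inherits the knowledge
  formulas themselves and not just their contents.\<close>

lemma ded_Know:
  assumes S: "mcs S" and "ded {Know i \<chi> | \<chi>. Know i \<chi> \<in> S} \<phi>"
  shows "Know i \<phi> \<in> S"
  using assms(2)
proof (induction rule: ded.induct)
  case (ded_SIG \<phi>)
  then show ?case by (intro mcs_SIG[OF S] NECK)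
next
  case (ded_hyp \<phi>)
  then obtain \<chi> where \<chi>: "\<phi> = Know i \<chi>" "Know i \<chi> \<in> S" by blast
  show ?case unfolding \<chi>(1) by (rule mcs_Imp_SIG[OF S Ax4 \<chi>(2)])
next
  case (ded_MP \<phi> \<psi>)
  show ?case by (rule mcs_Know_MP[OF S ded_MP.IH(2,1)])
qed

lemma Poss_witness:
  assumes S: "mcs S" and poss: "Poss i \<phi> \<in> S"
  shows "\<exists>T. mcs T \<and> same_know i S T \<and> \<phi> \<in> T"
proof -
  let ?K = "{Know i \<chi> | \<chi>. Know i \<chi> \<in> S}"
  have "\<not> ded (insert \<phi> ?K) (Neg Top)"
  proof
    assume "ded (insert \<phi> ?K) (Neg Top)"
    then have "Know i (Imp \<phi> (Neg Top)) \<in> S"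
      by (intro ded_Know[OF S] ded_deduction)
    then have "Know i (Neg \<phi>) \<in> S"
      by (rule mcs_Know_mono[OF S, rotated]) (auto intro!: TAUT simp: taut_simps)
    then show False using poss S by simp
  qed
  then obtain T where T: "insert \<phi> ?K \<subseteq> T" "mcs T" by (rule Lindenbaum)
  \<comment> \<open>The Lindenbaum extension could only err by adding knowledge; \<open>Ax5\<close>
    excludes this, because ignorance in \<open>S\<close> is itself known and so carried over to
    \<open>T\<close>.\<close>
  have "Know i \<chi> \<in> S" if "Know i \<chi> \<in> T" for \<chi>
  proof (rule ccontr)
    assume "Know i \<chi> \<notin> S"
    then have "Know i (Neg (Know i \<chi>)) \<in> S"
      using mcs_SIG[OF S Ax5, of i \<chi>] S by simp
    then have "Know i (Neg (Know i \<chi>)) \<in> T" using T(1) by blast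
    then have "Neg (Know i \<chi>) \<in> T" using mcs_Imp_SIG[OF T(2) AxT] by blast
    then show False using that T(2) by simp
  qed
  then show ?thesis using T by (auto simp: same_know_def)
qed

section \<open>Countable saturated families of maximal consistent sets\<close>

definition saturated :: "('i, 'a, 'p) fm set set \<Rightarrow> bool" where
  "saturated C \<longleftrightarrow> (\<forall>S\<in>C. mcs S) \<and>
     (\<forall>S\<in>C. \<forall>i \<phi>. Poss i \<phi> \<in> S \<longrightarrow> (\<exists>T\<in>C. same_know i S T \<and> \<phi> \<in> T)) \<and>
     (\<forall>S\<in>C. \<forall>a. Dia a Top \<in> S \<longrightarrow> box_image S a \<in> C)"

lemma fm_countable: "\<exists>f :: ('i, 'a, 'p) fm \<Rightarrow> nat. inj f"
  by countable_datatype

text \<open>A request is a pair of a player and a formula (asking for a witness) or an action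
  (asking for a successor). \<open>C\<close> collects the answers to all finite lists of requests
  starting from \<open>S\<^sub>0\<close>; there are countably many lists because formulas are
  countable.\<close>

lemma ex_countable_saturated:
  assumes "mcs S\<^sub>0"
  obtains C where "S\<^sub>0 \<in> C" "countable C" "saturated C"
proof -
  \<comment> \<open>A request that does not apply returns \<open>S\<close> unchanged, so every
    request acts on every set and maximal consistency is never lost.\<close>
  define poss where "poss S i \<phi> = (if Poss i \<phi> \<in> S then
      (SOME T. mcs T \<and> same_know i S T \<and> \<phi> \<in> T) else S)" for S i \<phi>
  define act where "act S a = (if Dia a Top \<in> S then box_image S a else S)" for S a
  define step where "step = (\<lambda>x S. case x of Inl (i, \<phi>) \<Rightarrow> poss S i \<phi> | Inr a \<Rightarrow> act S a)"
  define C where "C = range (\<lambda>xs. foldr step xs S\<^sub>0)"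
  have poss: "mcs (poss S i \<phi>) \<and> same_know i S (poss S i \<phi>) \<and> \<phi> \<in> poss S i \<phi>"
    if "mcs S" "Poss i \<phi> \<in> S" for S i \<phi>
    using someI_ex[OF Poss_witness[OF that]] that(2) by (simp only: poss_def if_True)
  have mcs_poss: "mcs (poss S i \<phi>)" if "mcs S" for S i \<phi>
    using poss[OF that] that by (cases "Poss i \<phi> \<in> S") (simp_all add: poss_def)
  have "mcs (step x S)" if "mcs S" for x S
  proof (cases x)
    case (Inl y)
    then show ?thesis using mcs_poss[OF that] by (cases y) (simp add: step_def)
  next
    case (Inr a)
    then show ?thesis
      using mcs_box_image[OF that] that by (simp add: step_def act_def del: mcs_derived)
  qed
  then have mcs_fold: "mcs (foldr step xs S\<^sub>0)" for xs
    using assms by (induction xs) auto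
  have step_C: "step x S \<in> C" if S: "S \<in> C" for x S
  proof -
    obtain xs where "S = foldr step xs S\<^sub>0" using S by (auto simp: C_def)
    then have "step x S = foldr step (x # xs) S\<^sub>0" by simp
    then show ?thesis unfolding C_def by (rule range_eqI)
  qed
  have "saturated C"
    unfolding saturated_def
  proof (intro conjI ballI allI impI)
    fix S assume S: "S \<in> C"
    show m: "mcs S" using S mcs_fold by (auto simp: C_def)
    show "\<exists>T\<in>C. same_know i S T \<and> \<phi> \<in> T" if "Poss i \<phi> \<in> S" for i \<phi>
      using poss[OF m that] step_C[OF S, of "Inl (i, \<phi>)"] by (auto simp: step_def)
    show "box_image S a \<in> C" if "Dia a Top \<in> S" for a
      using that step_C[OF S, of "Inr a"] by (auto simp: step_def act_def)
  qed
  moreover have "S\<^sub>0 \<in> C" unfolding C_def by (rule range_eqI[of _ _ "[]"]) simp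
  moreover have "countable C"
  proof -
    have "countable (UNIV :: ('i, 'a, 'p) fm set)"
      using fm_countable by (simp add: countable_def)
    then have "countable ((UNIV :: 'i set) \<times> (UNIV :: ('i, 'a, 'p) fm set) <+> (UNIV :: 'a set))"
      by (intro countable_Plus countable_SIGMA) (simp_all add: countable_finite)
    then have "countable (UNIV :: (('i \<times> ('i, 'a, 'p) fm) + 'a) set)"
      by (simp only: UNIV_Plus_UNIV UNIV_Times_UNIV)
    then have "countable (lists (UNIV :: (('i \<times> ('i, 'a, 'p) fm) + 'a) set))"
      by (rule countable_lists)
    then show ?thesis unfolding C_def lists_UNIV by (rule countable_image)
  qed
  ultimately show thesis using that by blast
qed

text \<open>States are codes: \<open>g\<close> carries the sets in \<open>C\<close> into the
  prescribed type of states and \<open>h\<close> decodes them.\<close>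

definition canonical_game ::
  "('i, 'a, 'p) fm set set \<Rightarrow> (('i, 'a, 'p) fm set \<Rightarrow> 's) \<Rightarrow> ('s, 'i, 'a, 'p) game" where
  "canonical_game C g = (let h = inv_into C g in
     \<lparr> states = g ` C,
       move = (\<lambda>s a. if Dia a Top \<in> h s then Some (g (box_image (h s) a)) else None),
       obs = (\<lambda>s i. {p. Piece p i \<in> h s}) \<rparr>)"

text \<open>\<open>k\<close> may hit any worlds, not only those built by \<open>Base\<close>,
  because the base type can be too small to hold \<open>C\<close>.\<close>

definition canonical_model ::
  "('i, 'a, 'p) fm set set \<Rightarrow> (('i, 'a, 'p) fm set \<Rightarrow> 's) \<Rightarrow>
   (('i, 'a, 'p) fm set \<Rightarrow> ('w, 'a) world) \<Rightarrow> ('w, 's, 'i, 'a, 'p) emodel" where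
  "canonical_model C g k =
     \<lparr> worlds = k ` C,
       state_of = (\<lambda>w. g (inv_into C k w)),
       indist = (\<lambda>i. {(k S, k T) | S T. S \<in> C \<and> T \<in> C \<and> same_know i S T}),
       val = (\<lambda>w i. {p. Piece p i \<in> inv_into C k w}) \<rparr>"

end

locale canonical = SIG_calculus Acts pc U
  for Acts :: "'i::finite \<Rightarrow> ('a::finite) set"
    and pc :: "'a \<Rightarrow> 'p::finite"
    and U :: "'i \<Rightarrow> ('a \<times> 'a) set" +
  fixes C :: "('i, 'a, 'p) fm set set"
    and g :: "('i, 'a, 'p) fm set \<Rightarrow> 's"
  assumes saturated: "saturated C" and inj_g: "inj_on g C"
begin

abbreviation "G \<equiv> canonical_game C g"
abbreviation "h \<equiv> inv_into C g"

lemma C_mcs [simp]: "S \<in> C \<Longrightarrow> mcs S"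
  and C_witness: "S \<in> C \<Longrightarrow> Poss i \<phi> \<in> S \<Longrightarrow> \<exists>T\<in>C. same_know i S T \<and> \<phi> \<in> T"
  and C_box_image: "S \<in> C \<Longrightarrow> Dia a Top \<in> S \<Longrightarrow> box_image S a \<in> C"
  using saturated unfolding saturated_def by blast+

lemma G_simps [simp]:
  "states G = g ` C"
  "obs G s i = {p. Piece p i \<in> h s}"
  "a \<in> enabled G s \<longleftrightarrow> Dia a Top \<in> h s"
  "Dia a Top \<in> h s \<Longrightarrow> move G s a = Some (g (box_image (h s) a))"
  by (auto simp: canonical_game_def Let_def enabled_def)

lemma h_g [simp]: "S \<in> C \<Longrightarrow> h (g S) = S"
  using inj_g by simp

lemma canonical_game_structure:
  assumes nonempty: "C \<noteq> {}" and cover: "(\<Union>i. Acts i) = UNIV"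
  shows "game_structure Acts pc G"
proof -
  have move: "move G (g S) a = (if Dia a Top \<in> S then Some (g (box_image S a)) else None)"
    if "S \<in> C" for S a
    using that by (simp add: canonical_game_def Let_def inj_g)
  have turn: "\<exists>i. to_move Acts G (g S) i" if S: "S \<in> C" and a: "Dia a Top \<in> S" for S a
  proof -
    have turn_iff: "TURN Acts j \<in> S \<longleftrightarrow> (\<exists>b\<in>Acts j. Dia b Top \<in> S)" for j
      using S by (simp add: TURN_def del: mcs_derived)
    obtain i where i: "a \<in> Acts i" using cover by blast
    have ex: "Imp (TURN Acts i) (BigAnd {j. j \<noteq> i} (\<lambda>j. Neg (TURN Acts j))) \<in> S"
      using mcs_SIG[OF C_mcs[OF S] EXTURN] .
    have "b \<in> Acts i" if "Dia b Top \<in> S" for b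
    proof -
      \<comment> \<open>The owners \<open>i\<close> and \<open>j\<close> of the two enabled actions
        both have the turn in \<open>S\<close>; \<open>EXTURN\<close> then forces
        \<open>j = i\<close>.\<close>
      obtain j where j: "b \<in> Acts j" using cover by blast
      have "TURN Acts i \<in> S" "TURN Acts j \<in> S" using a i j that turn_iff by blast+
      then show ?thesis using ex S j by auto
    qed
    then have "enabled G (g S) \<subseteq> Acts i" using S by auto
    moreover have "a \<in> enabled G (g S)" using S a by simp
    ultimately show ?thesis unfolding to_move_def by blast
  qed
  have info: "Piece (pc a) i \<in> S \<longleftrightarrow> Dia a Top \<in> S" if "S \<in> C" "a \<in> Acts i" for S a i
    using mcs_SIG[OF C_mcs[OF that(1)] INFO[where Acts = Acts and i = i, OF that(2)]] that(1) by (simp del: mcs_derived(4,5))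
  show ?thesis
    unfolding game_structure_def
    using nonempty turn info C_box_image
    by (auto simp: move simp del: mcs_derived split: if_splits)
qed

section \<open>Faithful models and the truth lemma\<close>

definition faithful :: "('w, 's, 'i, 'a, 'p) emodel \<Rightarrow> bool" where
  "faithful M \<longleftrightarrow>
     (\<forall>w\<in>worlds M. state_of M w \<in> states G) \<and>
     (\<forall>i w v. (w, v) \<in> indist M i \<longrightarrow> w \<in> worlds M \<and> v \<in> worlds M \<and>
        (\<forall>\<psi>. Know i \<psi> \<in> h (state_of M w) \<longrightarrow> \<psi> \<in> h (state_of M v))) \<and>
     (\<forall>w\<in>worlds M. \<forall>i \<psi>. Poss i \<psi> \<in> h (state_of M w) \<longrightarrow>
        (\<exists>v. (w, v) \<in> indist M i \<and> \<psi> \<in> h (state_of M v))) \<and>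
     (\<forall>w\<in>worlds M. \<forall>i. val M w i = obs G (state_of M w) i)"

lemma faithful_update:
  assumes M: "faithful M"
  shows "faithful (update G U M)"
proof -
  have C: "h (state_of M w) \<in> C" if "w \<in> worlds M" for w
    using M that unfolding faithful_def by (auto simp: inj_g)
  have know: "w \<in> worlds M" "v \<in> worlds M"
      "Know i \<psi> \<in> h (state_of M w) \<Longrightarrow> \<psi> \<in> h (state_of M v)"
    if "(w, v) \<in> indist M i" for i w v \<psi>
    using M that unfolding faithful_def by blast+
  have poss: "\<exists>v. (w, v) \<in> indist M i \<and> \<psi> \<in> h (state_of M v)"
    if "w \<in> worlds M" "Poss i \<psi> \<in> h (state_of M w)" for i w \<psi>
    using M that unfolding faithful_def by blast
  have succ_C: "box_image (h (state_of M w)) a \<in> C"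
    if "w \<in> worlds M" "Dia a Top \<in> h (state_of M w)" for w a
    using C_box_image C that by blast
  show ?thesis
    unfolding faithful_def
  proof (intro conjI ballI allI impI)
    fix x assume "x \<in> worlds (update G U M)"
    then show "state_of (update G U M) x \<in> states G"
      using succ_C by (auto simp del: mcs_derived)
  next
    fix i x y assume "(x, y) \<in> indist (update G U M) i"
    then show "x \<in> worlds (update G U M)" "y \<in> worlds (update G U M)" by auto
  next
    fix i x y \<psi>
    assume xy: "(x, y) \<in> indist (update G U M) i"
      and K: "Know i \<psi> \<in> h (state_of (update G U M) x)"
    obtain w a u b where [simp]: "x = Upd w a" "y = Upd u b"
      and w: "w \<in> worlds M" and a: "Dia a Top \<in> h (state_of M w)"
      and u: "u \<in> worlds M" and b: "Dia b Top \<in> h (state_of M u)"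
      and wu: "(w, u) \<in> indist M i" and ab: "(a, b) \<in> U i"
      and obs: "obs G (the (move G (state_of M w) a)) i = obs G (the (move G (state_of M u) b)) i"
      using xy by auto
    define S where "S = h (state_of M w)"
    define T where "T = h (state_of M u)"
    have S: "mcs S" "Dia a Top \<in> S" and T: "mcs T" "Dia b Top \<in> T"
      using w u a b C by (simp_all add: S_def T_def del: mcs_derived)
    have hx: "h (state_of (update G U M) x) = box_image S a"
      using succ_C[OF w a] a by (simp add: S_def del: mcs_derived)
    have hy: "h (state_of (update G U M) y) = box_image T b"
      using succ_C[OF u b] b by (simp add: T_def del: mcs_derived)
    note mS = mcs_box_image[OF S] and mT = mcs_box_image[OF T]
    \<comment> \<open>\<open>B\<close> is what \<open>i\<close> observes after either move, so
      \<open>obs_fm B i\<close> lies in both successor sets.\<close>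
    define B where "B = {p. Piece p i \<in> box_image S a}"
    have B: "B = {p. Piece p i \<in> box_image T b}"
      using obs hx hy by (simp add: B_def)
    have "\<psi> \<in> box_image T b"
    proof (rule ccontr)
      assume "\<psi> \<notin> box_image T b"
      then have "And (Neg \<psi>) (obs_fm B i) \<in> box_image T b" using mT B by simp
      then have D: "Dia b (And (Neg \<psi>) (obs_fm B i)) \<in> T"
        using mem_box_image(2)[OF T] by blast
      \<comment> \<open>If \<open>S\<close> knew that this cannot happen, faithfulness of
        \<open>M\<close> would transfer the negation to \<open>T\<close>, against
        \<open>D\<close>.\<close>
      have "Poss i (Dia b (And (Neg \<psi>) (obs_fm B i))) \<in> S"
      proof (rule ccontr)
        assume "\<not> ?thesis"
        then have "Know i (Neg (Dia b (And (Neg \<psi>) (obs_fm B i)))) \<in> S" using S by simp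
        then have "Neg (Dia b (And (Neg \<psi>) (obs_fm B i))) \<in> T"
          using know(3)[OF wu] by (simp add: S_def T_def)
        then show False using D T by (simp del: mcs_derived)
      qed
      \<comment> \<open>\<open>NM\<close> moves the possible failure of \<open>\<psi>\<close> past
        the action \<open>a\<close>, where it contradicts the assumed knowledge of
        \<open>\<psi>\<close>.\<close>
      then have "Box a (Imp (obs_fm B i) (Poss i (Neg \<psi>))) \<in> S"
        by (rule mcs_Imp_SIG[OF S(1) NM[where U = U and i = i, OF ab]])
      then have "Imp (obs_fm B i) (Poss i (Neg \<psi>)) \<in> box_image S a"
        using mem_box_image(1)[OF S] by blast
      then have "Know i (Neg (Neg \<psi>)) \<notin> box_image S a" using mS by (simp add: B_def)
      moreover have "Know i (Neg (Neg \<psi>)) \<in> box_image S a"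
        by (rule mcs_Know_mono[OF mS _ K[unfolded hx]]) (auto intro!: TAUT simp: taut_simps)
      ultimately show False by contradiction
    qed
    then show "\<psi> \<in> h (state_of (update G U M) y)" by (simp only: hy)
  next
    fix x i \<psi>
    assume "x \<in> worlds (update G U M)" and P: "Poss i \<psi> \<in> h (state_of (update G U M) x)"
    then obtain w a where [simp]: "x = Upd w a"
      and w: "w \<in> worlds M" and a: "Dia a Top \<in> h (state_of M w)"
      by auto
    define S where "S = h (state_of M w)"
    have S: "mcs S" "Dia a Top \<in> S"
      using w a C by (simp_all add: S_def del: mcs_derived)
    have hx: "h (state_of (update G U M) x) = box_image S a"
      using succ_C[OF w a] a by (simp add: S_def del: mcs_derived)
    note mS = mcs_box_image[OF S]
    define B where "B = {p. Piece p i \<in> box_image S a}"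
    txt \<open>The update product only relates worlds with equal observations, so the witness has to
      satisfy the observation formula as well; KE makes it known.\<close>
    obtain T where T: "mcs T" "same_know i (box_image S a) T" "\<psi> \<in> T"
      using Poss_witness[OF mS] P hx by metis
    have "Piece p i \<in> T \<longleftrightarrow> Piece p i \<in> box_image S a" for p
      using mcs_Piece_Know[OF T(1)] mcs_Piece_Know[OF mS] T(2) unfolding same_know_def by blast
    then have "obs_fm B i \<in> T" using T(1) by (simp add: B_def)
    \<comment> \<open>\<open>T\<close> contains the conjunction and so cannot know its negation;
      agreement on knowledge carries this back to the successor set of \<open>S\<close>.\<close>
    then have "Know i (Neg (And \<psi> (obs_fm B i))) \<notin> T"
      using mcs_Imp_SIG[OF T(1) AxT] T by fastforce
    then have "Poss i (And \<psi> (obs_fm B i)) \<in> box_image S a"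
      using T(2) mS by (simp add: same_know_def)
    then have "Dia a (Poss i (And \<psi> (obs_fm B i))) \<in> S"
      using mem_box_image(2)[OF S] by blast
    then have "BigOr {b. (a, b) \<in> U i} (\<lambda>b. Poss i (Dia b (And \<psi> (obs_fm B i)))) \<in> S"
      by (rule mcs_Imp_SIG[OF S(1) PR])
    \<comment> \<open>The disjunction of \<open>PR\<close> supplies the witness action, and
      faithfulness of \<open>M\<close> the world in which to perform it.\<close>
    then obtain b where ab: "(a, b) \<in> U i" and "Poss i (Dia b (And \<psi> (obs_fm B i))) \<in> S"
      using S(1) by (auto simp del: mcs_derived)
    then obtain u where wu: "(w, u) \<in> indist M i"
      and D: "Dia b (And \<psi> (obs_fm B i)) \<in> h (state_of M u)"
      using poss[OF w] by (auto simp: S_def)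
    define T' where "T' = h (state_of M u)"
    have u: "u \<in> worlds M" using know(2)[OF wu] .
    have T': "mcs T'" using u C by (simp add: T'_def)
    have bT: "Dia b Top \<in> T'" using Dia_imp_enabled[OF T'] D by (simp add: T'_def)
    have b: "Dia b Top \<in> h (state_of M u)" using bT by (simp add: T'_def)
    note mT = mcs_box_image[OF T' bT]
    have hy: "h (state_of (update G U M) (Upd u b)) = box_image T' b"
      using succ_C[OF u b] b by (simp add: T'_def del: mcs_derived)
    have "And \<psi> (obs_fm B i) \<in> box_image T' b"
      using mem_box_image(2)[OF T' bT] D by (simp add: T'_def)
    \<comment> \<open>The second conjunct equates the observations, the last condition for
      \<open>Upd u b\<close> to be related to \<open>x\<close>.\<close>
    then have "\<psi> \<in> box_image T' b" "{p. Piece p i \<in> box_image T' b} = B" using mT by auto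
    then show "\<exists>y. (x, y) \<in> indist (update G U M) i \<and> \<psi> \<in> h (state_of (update G U M) y)"
      using hx hy w a u b wu ab by (intro exI[of _ "Upd u b"]) (simp add: B_def del: mcs_derived)
  next
    fix x i assume "x \<in> worlds (update G U M)"
    then show "val (update G U M) x i = obs G (state_of (update G U M) x) i" by auto
  qed
qed

text \<open>The model is generalised because the \<open>Box\<close> case applies the induction
  hypothesis to the update product, faithful by the previous lemma.\<close>

lemma truth_lemma:
  "faithful M \<Longrightarrow> w \<in> worlds M \<Longrightarrow> sat G U M w \<phi> \<longleftrightarrow> \<phi> \<in> h (state_of M w)"
proof (induction \<phi> arbitrary: M w)
  case Top
  then show ?case unfolding faithful_def by auto
next
  case (Piece p i)
  then have "val M w i = obs G (state_of M w) i" unfolding faithful_def by blast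
  then show ?case by simp
next
  case (Neg \<phi>)
  moreover have "mcs (h (state_of M w))" using Neg.prems unfolding faithful_def by auto
  ultimately show ?case by simp
next
  case (And \<phi> \<psi>)
  moreover have "mcs (h (state_of M w))" using And.prems unfolding faithful_def by auto
  ultimately show ?case by simp
next
  case (Know i \<phi>)
  have m: "mcs (h (state_of M v))" if "v \<in> worlds M" for v
    using Know.prems that unfolding faithful_def by auto
  have know: "v \<in> worlds M \<and> (Know i \<phi> \<in> h (state_of M w) \<longrightarrow> \<phi> \<in> h (state_of M v))"
    if "(w, v) \<in> indist M i" for v
    using Know.prems that unfolding faithful_def by blast
  have "\<exists>v. (w, v) \<in> indist M i \<and> Neg \<phi> \<in> h (state_of M v)" if "Know i \<phi> \<notin> h (state_of M w)"
  proof -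
    have "Know i (Neg (Neg \<phi>)) \<in> h (state_of M w) \<Longrightarrow> Know i \<phi> \<in> h (state_of M w)"
      by (rule mcs_Know_mono[OF m[OF Know.prems(2)]]) (auto intro!: TAUT simp: taut_simps)
    then have "Poss i (Neg \<phi>) \<in> h (state_of M w)"
      using that m[OF Know.prems(2)] by auto
    then show ?thesis using Know.prems unfolding faithful_def by blast
  qed
  then show ?case using know Know.IH[OF Know.prems(1)] m by (metis mcs_Neg sat.simps(5))
next
  case (Box a \<phi>)
  have S: "h (state_of M w) \<in> C" "mcs (h (state_of M w))"
    using Box.prems unfolding faithful_def by auto
  show ?case
  proof (cases "Dia a Top \<in> h (state_of M w)")
    case True
    then have "sat G U (update G U M) (Upd w a) \<phi> \<longleftrightarrow>
        \<phi> \<in> h (state_of (update G U M) (Upd w a))"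
      using Box.prems by (intro Box.IH faithful_update) (simp_all del: mcs_derived)
    also have "\<dots> \<longleftrightarrow> Box a \<phi> \<in> h (state_of M w)"
      using True C_box_image[OF S(1) True] mem_box_image(1)[OF S(2) True]
      by (simp del: mcs_derived)
    finally show ?thesis using True by simp
  next
    case False
    \<comment> \<open>For a disabled action the semantic side is vacuously true, so
      \<open>Box a \<phi>\<close> has to be shown to lie in the state.\<close>
    then have "Dia a (Neg \<phi>) \<notin> h (state_of M w)" using Dia_imp_enabled[OF S(2)] by blast
    then have "Box a (Neg (Neg \<phi>)) \<in> h (state_of M w)" using S(2) by simp
    then have "Box a \<phi> \<in> h (state_of M w)"
      by (rule mcs_Imp_SIG[OF S(2) SIG_Box_mono, rotated])
        (auto intro!: TAUT simp: taut_simps)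
    then show ?thesis using False by (simp del: mcs_derived)
  qed
qed

lemma canonical_model_props:
  fixes k :: "('i, 'a, 'p) fm set \<Rightarrow> ('w, 'a) world"
  assumes nonempty: "C \<noteq> {}" and k: "inj_on k C"
  shows "epistemic_model G (canonical_model C g k)" and "faithful (canonical_model C g k)"
proof -
  let ?M = "canonical_model C g k"
  have M: "worlds ?M = k ` C" "S \<in> C \<Longrightarrow> state_of ?M (k S) = g S"
    "indist ?M i = {(k S, k T) | S T. S \<in> C \<and> T \<in> C \<and> same_know i S T}"
    "S \<in> C \<Longrightarrow> val ?M (k S) i = {p. Piece p i \<in> S}" for S i
    using k by (simp_all add: canonical_model_def)
  have eq: "equiv (worlds ?M) (indist ?M i)" for i
  proof (rule equivI)
    show "refl_on (worlds ?M) (indist ?M i)"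
      by (rule refl_onI) (auto simp: M same_know_def)
    show "sym (indist ?M i)"
      by (rule symI) (auto simp: M same_know_def)
    \<comment> \<open>Two sets coded by the same middle world coincide by injectivity of
      \<open>k\<close>.\<close>
    show "trans (indist ?M i)"
      using k by (intro transI) (auto simp: M same_know_def inj_on_eq_iff, blast)
    show "indist ?M i \<subseteq> worlds ?M \<times> worlds ?M"
      by (auto simp: M)
  qed
  have obs: "{p. Piece p i \<in> S} = {p. Piece p i \<in> T}" if "S \<in> C" "T \<in> C" "same_know i S T" for i S T
    using that mcs_Piece_Know[OF C_mcs, of S i] mcs_Piece_Know[OF C_mcs, of T i]
    by (simp add: same_know_def)
  show "epistemic_model G ?M"
    unfolding epistemic_model_def using nonempty eq
    by (auto simp: M) (use obs in blast)+
  have "\<psi> \<in> T" if "T \<in> C" "same_know i S T" "Know i \<psi> \<in> S" for i \<psi> S T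
    using that mcs_Imp_SIG[OF C_mcs AxT] by (auto simp: same_know_def)
  moreover have "\<exists>v. (k S, v) \<in> indist ?M i \<and> \<psi> \<in> h (state_of ?M v)"
    if S: "S \<in> C" and P: "Poss i \<psi> \<in> S" for S i \<psi>
  proof -
    obtain T where "T \<in> C" "same_know i S T" "\<psi> \<in> T" using C_witness[OF S P] by blast
    then show ?thesis using S by (intro exI[of _ "k T"]) (auto simp: M)
  qed
  ultimately show "faithful ?M"
    unfolding faithful_def by (auto simp: M simp del: mcs_derived)
qed

end

section \<open>Completeness\<close>

lemma infinite_UNIV_world: "infinite (UNIV :: ('w, 'a) world set)"
proof -
  let ?f = "\<lambda>n::nat. ((\<lambda>w. Upd w undefined) ^^ n) (Base undefined) :: ('w, 'a) world"
  have "size (?f n) = Suc n" for n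
    by (induction n) auto
  \<comment> \<open>\<open>Base undefined\<close> has size 1, so subtracting 1 recovers the number
    of updates and gives a left inverse.\<close>
  then have "size (?f n) - 1 = n" for n by simp
  then have "inj ?f" by (rule inj_on_inverseI)
  then show ?thesis by (rule infinite_super[OF subset_UNIV range_inj_infinite])
qed

lemma countable_inj_into_infinite:
  assumes "countable C" "infinite (UNIV :: 't set)"
  obtains g :: "'c \<Rightarrow> 't" where "inj_on g C"
proof -
  obtain f :: "'c \<Rightarrow> nat" where f: "inj_on f C" using assms(1) by (rule countableE)
  obtain e :: "nat \<Rightarrow> 't" where "inj e" using assms(2) infinite_countable_subset by blast
  then have "inj_on (e \<circ> f) C" using f by (meson comp_inj_on inj_on_subset subset_UNIV)
  then show thesis by (rule that)
qed

lemma SIG_complete: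
  fixes Acts :: "'i::finite \<Rightarrow> ('a::finite) set"
    and pc :: "'a \<Rightarrow> 'p::finite"
  assumes cover: "(\<Union>i. Acts i) = UNIV" and inf: "infinite (UNIV :: 't set)"
    and valid: "valid TYPE('t) TYPE('v) Acts pc U \<phi>"
  shows "SIG Acts pc U \<phi>"
proof (rule ccontr)
  assume not: "\<not> SIG Acts pc U \<phi>"
  interpret SIG_calculus Acts pc U .
  have "\<not> ded {Neg \<phi>} (Neg Top)"
  proof
    assume "ded {Neg \<phi>} (Neg Top)"
    then have "ded {} (Imp (Neg \<phi>) (Neg Top))" by (rule ded_deduction)
    \<comment> \<open>Without hypotheses \<open>ded\<close> only chains theorems of
      \<open>SIG\<close> by modus ponens.\<close>
    then have "SIG Acts pc U (Imp (Neg \<phi>) (Neg Top))"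
      by (induction rule: ded.induct) (auto intro: SIG.MP)
    moreover have "SIG Acts pc U (Imp (Imp (Neg \<phi>) (Neg Top)) \<phi>)"
      by (rule TAUT) (simp add: taut_simps)
    ultimately show False using not SIG.MP by blast
  qed
  then obtain S where S: "{Neg \<phi>} \<subseteq> S" "mcs S" by (rule Lindenbaum)
  obtain C where C: "S \<in> C" "countable C" "saturated C" using ex_countable_saturated[OF S(2)] .
  obtain g :: "('i, 'a, 'p) fm set \<Rightarrow> 't" where g: "inj_on g C"
    using countable_inj_into_infinite[OF C(2) inf] .
  obtain k :: "('i, 'a, 'p) fm set \<Rightarrow> ('v, 'a) world" where k: "inj_on k C"
    using countable_inj_into_infinite[OF C(2) infinite_UNIV_world] .
  interpret canonical Acts pc U C g by unfold_locales (fact C g)+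
  let ?M = "canonical_model C g k"
  have ne: "C \<noteq> {}" using C(1) by blast
  note M = canonical_model_props[OF ne k]
  \<comment> \<open>The world coding \<open>S\<close> refutes \<open>\<phi>\<close>, since
    \<open>S\<close> contains \<open>Neg \<phi>\<close>.\<close>
  have kS: "k S \<in> worlds ?M" "h (state_of ?M (k S)) = S"
    using C(1) k by (simp_all add: canonical_model_def)
  have "sat G U ?M (k S) \<phi>"
    using valid canonical_game_structure[OF ne cover] M(1) kS(1) unfolding valid_def by blast
  then have "\<phi> \<in> S" using truth_lemma[OF M(2) kS(1)] kS(2) by simp
  then show False using S by auto
qed

text \<open>Each direction has its own types: soundness holds over any choice, while completeness
  needs validity over just one choice with infinitely many potential states.\<close>

theorem theorem33:
  fixes Acts :: "'i::finite \<Rightarrow> ('a::finite) set"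
    and pc :: "'a \<Rightarrow> 'p::finite"
    and U :: "'i \<Rightarrow> ('a \<times> 'a) set"
    and \<phi> :: "('i, 'a, 'p) fm"
  assumes "disjoint_family Acts" and "(\<Union>i. Acts i) = UNIV"
    and "observation_model U"
  shows "(SIG Acts pc U \<phi> \<longrightarrow> valid TYPE('s) TYPE('w) Acts pc U \<phi>) \<and>
         (infinite (UNIV :: 't set) \<longrightarrow> valid TYPE('t) TYPE('v) Acts pc U \<phi> \<longrightarrow> SIG Acts pc U \<phi>)"
proof (intro conjI impI)
  show "valid TYPE('s) TYPE('w) Acts pc U \<phi>" if "SIG Acts pc U \<phi>"
    unfolding valid_def using SIG_sound[OF assms(1,3) _ that] by blast
  show "SIG Acts pc U \<phi>" if "infinite (UNIV :: 't set)" "valid TYPE('t) TYPE('v) Acts pc U \<phi>"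
    using assms(2) that by (rule SIG_complete)
qed

end
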